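(* Suppose $(X,\mathscr{A},\mu)$ is a non-atomic probability measure space. Then $\mathcal{M}_\mu$ is path connected (and hence, connected).
   Context: A set $A\in\mathscr{A}$ is an atom of $\mu$ if $\mu(A)>0$ and for every $B\in\mathscr{A}$ either $\mu(A\cap B)=0$ or $\mu(A\setminus B)=0$. The measure space is non-atomic if it contains no atoms. $\mathcal{M}$ is the ring of real-valued measurable functions on $(X,\mathscr{A},\mu)$, where two functions that are equal $\mu$-almost everywhere are identified. A sequence $\{f_n\}$ in $\mathcal{M}$ converges in measure to $f\in\mathcal{M}$ if for each $c>0$, $\lim_{n\to\infty}\mu(\{x\in X:|f_n(x)-f(x)|>c\})=0$. For $A\subseteq\mathcal{M}$, $\overline{A}$ is the set of all $f\in\mathcal{M}$ for which there is a sequence in $A$ converging to $f$ in measure. $\mathcal{M}_\mu$ denotes $\mathcal{M}$ with the topology of convergence in measure, i.e. the topology $\{\mathcal{M}\setminus A: A\subseteq\mathcal{M},\ A=\overline{A}\}$. *)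

theory Defs
  imports "HOL-Probability.Probability_Measure"
begin

definition is_atom :: "'a measure \<Rightarrow> 'a set \<Rightarrow> bool" where
  "is_atom M A \<longleftrightarrow> A \<in> sets M \<and> emeasure M A > 0 \<and>
     (\<forall>B\<in>sets M. emeasure M (A \<inter> B) = 0 \<or> emeasure M (A - B) = 0)"

definition non_atomic :: "'a measure \<Rightarrow> bool" where
  "non_atomic M \<longleftrightarrow> (\<nexists>A. is_atom M A)"

(* HOL functions are total on the type, so a measurable function on the space of M is represented
   by its extensions to the type; ae_eq also identifies these, as AE only refers to the space. *)
definition ae_eq :: "'a measure \<Rightarrow> (('a \<Rightarrow> real) \<times> ('a \<Rightarrow> real)) set" where
  "ae_eq M = {(f, g). f \<in> borel_measurable M \<and> g \<in> borel_measurable M \<and> (AE x in M. f x = g x)}"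

definition meas_classes :: "'a measure \<Rightarrow> ('a \<Rightarrow> real) set set" where
  "meas_classes M = borel_measurable M // ae_eq M"

definition fun_conv_in_measure :: "'a measure \<Rightarrow> (nat \<Rightarrow> 'a \<Rightarrow> real) \<Rightarrow> ('a \<Rightarrow> real) \<Rightarrow> bool" where
  "fun_conv_in_measure M f g \<longleftrightarrow>
     (\<forall>c>0. (\<lambda>n. emeasure M {x \<in> space M. \<bar>f n x - g x\<bar> > c}) \<longlonglongrightarrow> 0)"

(* The choice of representatives is immaterial, see conv_in_measure_iff below. *)
definition conv_in_measure ::
    "'a measure \<Rightarrow> (nat \<Rightarrow> ('a \<Rightarrow> real) set) \<Rightarrow> ('a \<Rightarrow> real) set \<Rightarrow> bool" where
  "conv_in_measure M F G \<longleftrightarrow>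
     (\<forall>n. F n \<in> meas_classes M) \<and> G \<in> meas_classes M \<and>
     (\<forall>f g. (\<forall>n. f n \<in> F n) \<longrightarrow> g \<in> G \<longrightarrow> fun_conv_in_measure M f g)"

definition measure_closure :: "'a measure \<Rightarrow> ('a \<Rightarrow> real) set set \<Rightarrow> ('a \<Rightarrow> real) set set" where
  "measure_closure M A = {G \<in> meas_classes M. \<exists>F. (\<forall>n. F n \<in> A) \<and> conv_in_measure M F G}"

(* istopology_conv_in_measure below shows that this does specify a topology. *)
definition conv_in_measure_topology :: "'a measure \<Rightarrow> ('a \<Rightarrow> real) set topology" where
  "conv_in_measure_topology M = topology (\<lambda>U. \<exists>A\<subseteq>meas_classes M.
     A = measure_closure M A \<and> U = meas_classes M - A)"

lemma equiv_ae_eq: "equiv (borel_measurable M) (ae_eq M)"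
proof (rule equivI)
  show "ae_eq M \<subseteq> borel_measurable M \<times> borel_measurable M"
    by (auto simp: ae_eq_def)
  show "refl_on (borel_measurable M) (ae_eq M)"
    by (auto simp: refl_on_def ae_eq_def)
  show "sym (ae_eq M)"
  proof (rule symI)
    fix f g assume "(f, g) \<in> ae_eq M"
    moreover from this have "AE x in M. f x = g x" by (simp add: ae_eq_def)
    then have "AE x in M. g x = f x" by eventually_elim simp
    ultimately show "(g, f) \<in> ae_eq M" by (simp add: ae_eq_def)
  qed
  show "trans (ae_eq M)"
  proof (rule transI)
    fix f g h assume "(f, g) \<in> ae_eq M" "(g, h) \<in> ae_eq M"
    moreover from this have "AE x in M. f x = g x" "AE x in M. g x = h x"
      by (auto simp: ae_eq_def)
    then have "AE x in M. f x = h x" by eventually_elim simp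
    ultimately show "(f, h) \<in> ae_eq M" by (auto simp: ae_eq_def)
  qed
qed

lemma meas_classes_same_class:
  assumes "G \<in> meas_classes M" "f \<in> G" "g \<in> G"
  shows "f \<in> borel_measurable M" "g \<in> borel_measurable M" "AE x in M. f x = g x"
proof -
  have "(f, g) \<in> ae_eq M"
    using assms quotient_eq_iff[OF equiv_ae_eq, of G M G f g] by (auto simp: meas_classes_def)
  then show "f \<in> borel_measurable M" "g \<in> borel_measurable M" "AE x in M. f x = g x"
    by (auto simp: ae_eq_def)
qed

lemma meas_classes_nonempty: "G \<in> meas_classes M \<Longrightarrow> \<exists>g. g \<in> G"
  using in_quotient_imp_non_empty[OF equiv_ae_eq] by (auto simp: meas_classes_def)

lemma conv_in_measure_iff:
  assumes F: "\<And>n. F n \<in> meas_classes M" and G: "G \<in> meas_classes M"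
    and f: "\<And>n. f n \<in> F n" and g: "g \<in> G"
  shows "conv_in_measure M F G \<longleftrightarrow> fun_conv_in_measure M f g"
proof -
  have "emeasure M {x \<in> space M. \<bar>f n x - g x\<bar> > c} = emeasure M {x \<in> space M. \<bar>f' n x - g' x\<bar> > c}"
    if f': "\<forall>n. f' n \<in> F n" and g': "g' \<in> G" for f' g' c n
  proof (rule emeasure_eq_AE)
    note m = meas_classes_same_class[OF F f f'[rule_format], of n]
      meas_classes_same_class[OF G g g']
    note [measurable] = m(1,2,4,5)
    show "AE x in M. x \<in> {x \<in> space M. \<bar>f n x - g x\<bar> > c}
        \<longleftrightarrow> x \<in> {x \<in> space M. \<bar>f' n x - g' x\<bar> > c}"
      using m(3,6) by eventually_elim simp
    show "{x \<in> space M. \<bar>f n x - g x\<bar> > c} \<in> sets M"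
      "{x \<in> space M. \<bar>f' n x - g' x\<bar> > c} \<in> sets M"
      by measurable
  qed
  then have "fun_conv_in_measure M f g \<longleftrightarrow> fun_conv_in_measure M f' g'"
    if "\<forall>n. f' n \<in> F n" "g' \<in> G" for f' g'
    using that by (simp add: fun_conv_in_measure_def)
  then show ?thesis
    using assms by (auto simp: conv_in_measure_def)
qed

lemma conv_in_measure_const:
  assumes "G \<in> meas_classes M" shows "conv_in_measure M (\<lambda>_. G) G"
proof -
  obtain g where "g \<in> G" using meas_classes_nonempty[OF assms] by blast
  then show ?thesis
    using assms by (subst conv_in_measure_iff[where f = "\<lambda>_. g" and g = g])
      (auto simp: fun_conv_in_measure_def)
qed

lemma conv_in_measure_subseq:
  assumes c: "conv_in_measure M F G" and r: "strict_mono r"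
  shows "conv_in_measure M (F \<circ> r) G"
proof -
  have F: "\<And>n. F n \<in> meas_classes M" and G: "G \<in> meas_classes M"
    using c by (auto simp: conv_in_measure_def)
  obtain f where f: "\<And>n. f n \<in> F n"
    using meas_classes_nonempty[OF F] by metis
  obtain g where g: "g \<in> G"
    using meas_classes_nonempty[OF G] by metis
  have "fun_conv_in_measure M f g"
    using conv_in_measure_iff[OF F G f g] c by simp
  then have "fun_conv_in_measure M (f \<circ> r) g"
    using LIMSEQ_subseq_LIMSEQ[OF _ r] unfolding fun_conv_in_measure_def o_def by blast
  then show ?thesis
    using F G f g by (subst conv_in_measure_iff[where f = "f \<circ> r" and g = g]) auto
qed

lemma measure_closure_superset: "A \<subseteq> meas_classes M \<Longrightarrow> A \<subseteq> measure_closure M A"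
  using conv_in_measure_const by (fastforce simp: measure_closure_def)

lemma measure_closure_mono: "A \<subseteq> B \<Longrightarrow> measure_closure M A \<subseteq> measure_closure M B"
  by (fastforce simp: measure_closure_def)

lemma measure_closure_Un: "measure_closure M (A \<union> B) \<subseteq> measure_closure M A \<union> measure_closure M B"
proof
  fix G assume "G \<in> measure_closure M (A \<union> B)"
  then obtain F where G: "G \<in> meas_classes M" and F: "\<And>n. F n \<in> A \<union> B"
    and c: "conv_in_measure M F G"
    by (auto simp: measure_closure_def)
  have "{n. F n \<in> A} \<union> {n. F n \<in> B} = UNIV" using F by auto
  then have "infinite {n. F n \<in> A} \<or> infinite {n. F n \<in> B}"
    by (metis finite_Un infinite_UNIV_nat)
  moreover have "G \<in> measure_closure M C" if inf: "infinite {n. F n \<in> C}" for C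
  proof -
    obtain r :: "nat \<Rightarrow> nat" where r: "strict_mono r" "\<And>n. r n \<in> {n. F n \<in> C}"
      using infinite_enumerate[OF inf] by blast
    then have "\<forall>n. (F \<circ> r) n \<in> C" by simp
    then show ?thesis
      using G conv_in_measure_subseq[OF c r(1)] unfolding measure_closure_def by blast
  qed
  ultimately show "G \<in> measure_closure M A \<union> measure_closure M B" by blast
qed

lemma istopology_conv_in_measure:
  "istopology (\<lambda>U. \<exists>A\<subseteq>meas_classes M. A = measure_closure M A \<and> U = meas_classes M - A)"
proof -
  let ?L = "\<lambda>U. \<exists>A\<subseteq>meas_classes M. A = measure_closure M A \<and> U = meas_classes M - A"
  have "?L (S \<inter> T)" if ST: "?L S" "?L T" for S T
  proof -
    obtain A B where AB: "A \<subseteq> meas_classes M" "A = measure_closure M A" "S = meas_classes M - A"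
      "B \<subseteq> meas_classes M" "B = measure_closure M B" "T = meas_classes M - B"
      using ST by blast
    have "A \<union> B = measure_closure M (A \<union> B)"
      using measure_closure_superset[of "A \<union> B" M] measure_closure_Un[of M A B] AB by blast
    moreover have "S \<inter> T = meas_classes M - (A \<union> B)" using AB(3,6) by blast
    moreover have "A \<union> B \<subseteq> meas_classes M" using AB(1,4) by blast
    ultimately show ?thesis by (intro exI[of _ "A \<union> B"] conjI)
  qed
  moreover have "?L (\<Union>K)" if K: "\<forall>U\<in>K. ?L U" for K
  proof -
    define A where "A = meas_classes M - \<Union>K"
    have A: "A \<subseteq> meas_classes M" by (auto simp: A_def)
    have "measure_closure M A \<subseteq> A"
    proof
      fix G assume G: "G \<in> measure_closure M A"
      have "G \<notin> U" if U: "U \<in> K" for U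
      proof -
        obtain B where B: "B \<subseteq> meas_classes M" "B = measure_closure M B" "U = meas_classes M - B"
          using bspec[OF K U] by (elim exE conjE)
        have "A \<subseteq> B" using B(1,3) U by (auto simp: A_def)
        then have "G \<in> B" using measure_closure_mono[of A B M] G B(2) by blast
        then show ?thesis using B(3) by simp
      qed
      moreover have "G \<in> meas_classes M" using G by (auto simp: measure_closure_def)
      ultimately show "G \<in> A" by (auto simp: A_def)
    qed
    then have "A = measure_closure M A" using measure_closure_superset[OF A] by blast
    moreover have "\<Union>K = meas_classes M - A"
    proof -
      have "U \<subseteq> meas_classes M" if "U \<in> K" for U
        using bspec[OF K that] by (elim exE conjE) simp
      then show ?thesis unfolding A_def by blast
    qed
    ultimately show ?thesis using A by (intro exI[of _ A] conjI)
  qed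
  ultimately show ?thesis unfolding istopology_def by presburger
qed

lemma openin_conv_in_measure_topology:
  "openin (conv_in_measure_topology M) U \<longleftrightarrow>
     (\<exists>A\<subseteq>meas_classes M. A = measure_closure M A \<and> U = meas_classes M - A)"
  unfolding conv_in_measure_topology_def
  by (subst topology_inverse'[OF istopology_conv_in_measure]) (rule refl)

lemma topspace_conv_in_measure_topology: "topspace (conv_in_measure_topology M) = meas_classes M"
proof -
  have "measure_closure M {} = {}" by (auto simp: measure_closure_def)
  then have "openin (conv_in_measure_topology M) (meas_classes M)"
    unfolding openin_conv_in_measure_topology by (intro exI[of _ "{}"]) auto
  moreover have "topspace (conv_in_measure_topology M) \<subseteq> meas_classes M"
    using openin_topspace[of "conv_in_measure_topology M"]
    unfolding openin_conv_in_measure_topology by blast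
  ultimately show ?thesis using openin_subset by blast
qed

end

(* On a finite measure space, pointwise convergence implies convergence in measure. Hence
   f + t (g - f) converges in measure to f + s (g - f) as t tends to s, and the straight segment
   from f to g is a path. *)
theory Submission
  imports Defs
begin

text \<open>For fixed \<open>c\<close>, each point lies outside the exceptional sets
  \<open>E n\<close> from some index on, so their indicators tend to 0 pointwise. The constant 1
  dominates them and is integrable because the measure is finite, so dominated convergence sends the
  measures of \<open>E n\<close> to 0.\<close>

lemma (in finite_measure) fun_conv_in_measure_pointwise:
  assumes [measurable]: "\<And>n. f n \<in> borel_measurable M" "g \<in> borel_measurable M"
    and lim: "\<And>x. x \<in> space M \<Longrightarrow> (\<lambda>n. f n x) \<longlonglongrightarrow> g x"
  shows "fun_conv_in_measure M f g"
  unfolding fun_conv_in_measure_def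
proof (intro allI impI)
  fix c :: real assume c: "c > 0"
  define E where "E n = {x \<in> space M. \<bar>f n x - g x\<bar> > c}" for n
  have [measurable]: "E n \<in> sets M" for n unfolding E_def by measurable
  have "(\<lambda>n. \<integral>x. indicat_real (E n) x \<partial>M) \<longlonglongrightarrow> (\<integral>x. 0 \<partial>M)"
  proof (rule integral_dominated_convergence[where w = "\<lambda>_. 1"])
    show "AE x in M. (\<lambda>n. indicat_real (E n) x) \<longlonglongrightarrow> 0"
    proof (rule AE_I2)
      fix x assume x: "x \<in> space M"
      have "eventually (\<lambda>n. \<bar>f n x - g x\<bar> < c) sequentially"
        using tendstoD[OF lim[OF x] c] by (simp add: dist_real_def)
      then have "eventually (\<lambda>n. indicat_real (E n) x = 0) sequentially"
        by eventually_elim (simp add: E_def)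
      then show "(\<lambda>n. indicat_real (E n) x) \<longlonglongrightarrow> 0" by (rule tendsto_eventually)
    qed
  qed (auto simp: indicator_def)
  then have "(\<lambda>n. ennreal (measure M (E n))) \<longlonglongrightarrow> ennreal 0"
    by (intro tendsto_ennrealI) simp
  then show "(\<lambda>n. emeasure M {x \<in> space M. \<bar>f n x - g x\<bar> > c}) \<longlonglongrightarrow> 0"
    by (simp add: emeasure_eq_measure E_def)
qed

text \<open>Taking complements is injective on subsets of \<open>meas_classes M\<close>, so the set
  in the description of an open set is determined by it. This form allows continuity to be tested on
  preimages of closed sets.\<close>

lemma closedin_conv_in_measure_topology:
  "closedin (conv_in_measure_topology M) A \<longleftrightarrow> A \<subseteq> meas_classes M \<and> A = measure_closure M A"
proof -
  have "B = A" if "A \<subseteq> meas_classes M" "B \<subseteq> meas_classes M"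
    "meas_classes M - A = meas_classes M - B" for B
    using that by blast
  then show ?thesis
    unfolding closedin_def topspace_conv_in_measure_topology openin_conv_in_measure_topology
    by metis
qed

lemma ae_eq_class_self: "f \<in> borel_measurable M \<Longrightarrow> f \<in> ae_eq M `` {f}"
  by (rule equiv_class_self[OF equiv_ae_eq])

lemma ae_eq_class_in_meas_classes: "f \<in> borel_measurable M \<Longrightarrow> ae_eq M `` {f} \<in> meas_classes M"
  unfolding meas_classes_def by (rule quotientI)

text \<open>Sequential continuity is enough: closed sets of the target are those stable under limits
  in measure of sequences, and closedness in the real line is sequential too. No metric on the
  target is required.\<close>

lemma (in finite_measure) pathin_segment:
  assumes [measurable]: "f \<in> borel_measurable M" "g \<in> borel_measurable M"
  shows "pathin (conv_in_measure_topology M) (\<lambda>t. ae_eq M `` {\<lambda>x. f x + t * (g x - f x)})"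
proof -
  define h where "h t x = f x + t * (g x - f x)" for t x
  define p where "p t = ae_eq M `` {h t}" for t
  have [measurable]: "h t \<in> borel_measurable M" for t unfolding h_def by measurable
  have hp: "h t \<in> p t" and p: "p t \<in> meas_classes M" for t
    unfolding p_def by (rule ae_eq_class_self ae_eq_class_in_meas_classes, measurable)+
  have conv: "conv_in_measure M (\<lambda>n. p (t n)) (p s)" if "t \<longlonglongrightarrow> s" for t s
  \<comment> \<open>Convergence of classes may be tested on one choice of representatives; the
    functions \<open>h (t n)\<close> converge to \<open>h s\<close> at every point.\<close>
  proof (subst conv_in_measure_iff[where f = "\<lambda>n. h (t n)" and g = "h s"])
    show "fun_conv_in_measure M (\<lambda>n. h (t n)) (h s)"
      using that by (intro fun_conv_in_measure_pointwise) (auto simp: h_def intro!: tendsto_intros)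
  qed (auto intro: hp p)
  have "continuous_map (top_of_set {0..1}) (conv_in_measure_topology M) p"
    unfolding continuous_map_closedin
  proof (intro conjI ballI allI impI)
    fix C assume C: "closedin (conv_in_measure_topology M) C"
    have "closed {t \<in> {0..1}. p t \<in> C}"
      unfolding closed_sequential_limits
    proof (intro allI impI, elim conjE)
      fix t s assume t: "\<forall>n. t n \<in> {t \<in> {0..1}. p t \<in> C}" "t \<longlonglongrightarrow> s"
      have "s \<in> {0..1}" using closed_sequentially[of "{0..1::real}" t s] t by auto
      \<comment> \<open>The classes \<open>p (t n)\<close> in \<open>C\<close> are themselves the
        approximating sequence for \<open>p s\<close>; as \<open>C\<close> is closed, it contains
        this limit.\<close>
      moreover have "p s \<in> measure_closure M C"
        using conv[OF t(2)] p t(1) by (auto simp: measure_closure_def)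
      ultimately show "s \<in> {t \<in> {0..1}. p t \<in> C}"
        using C unfolding closedin_conv_in_measure_topology by blast
    qed
    then show "closedin (top_of_set {0..1}) {t \<in> topspace (top_of_set {0..1}). p t \<in> C}"
      by (auto intro!: closed_subset)
  qed (simp add: topspace_conv_in_measure_topology p)
  then show ?thesis by (simp add: pathin_def p_def[abs_def] h_def[abs_def])
qed

lemma (in finite_measure) path_connected_conv_in_measure_topology:
  "path_connected_space (conv_in_measure_topology M)"
  unfolding path_connected_space_def topspace_conv_in_measure_topology
proof (intro ballI)
  fix F G assume "F \<in> meas_classes M" "G \<in> meas_classes M"
  then obtain f g where f: "f \<in> borel_measurable M" "F = ae_eq M `` {f}"
    and g: "g \<in> borel_measurable M" "G = ae_eq M `` {g}"
    by (auto simp: meas_classes_def elim!: quotientE)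
  \<comment> \<open>The witness is left open and fixed by \<open>pathin_segment\<close>; its
    representatives at 0 and 1 simplify to \<open>f\<close> and \<open>g\<close>.\<close>
  show "\<exists>p. pathin (conv_in_measure_topology M) p \<and> p 0 = F \<and> p 1 = G"
    by (rule exI, intro conjI, rule pathin_segment[OF f(1) g(1)]) (simp_all add: f(2) g(2))
qed

theorem theorem4p1:
  fixes M :: "'a measure"
  assumes "prob_space M" and "non_atomic M"
  shows "path_connected_space (conv_in_measure_topology M) \<and>
         connected_space (conv_in_measure_topology M)"
proof -
  interpret prob_space M by fact
  show ?thesis
    using path_connected_conv_in_measure_topology path_connected_imp_connected_space by blast
qed

end
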